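(* Let $\mathcal G=\{\mathcal V,\mathcal E\}$ be a connected simple bi-directed graph on $\mathcal V=\{1,\dots,m\}$ with adjacency matrix $[a_{ij}]$ and a clustering $\mathcal C=\{\mathcal C_1,\dots,\mathcal C_K\}$, let $L=[l_{ij}]_{i,j=1}^m$ be the associated weighted Laplacian (defined in the context), and let $d^\top=[d_1,\dots,d_m]$, with all $d_i>0$, be a left eigenvector of $L$ associated with the eigenvalue $0$. Let $f_1,\dots,f_K:\mathbb R^n\to\mathbb R^n$ be continuous, $\Gamma\in\mathbb R^{n\times n}$, let $\rho_{ij}>0$ be constants, and consider the adaptive system $$\dot x^i(t)=f_k(x^i(t))+\sum_{j=1}^m a_{ij}w_{ij}(t)\Gamma[x^j(t)-x^i(t)],\qquad i\in\mathcal C_k,\ k=1,\dots,K,$$ $$\dot w_{ij}(t)=\rho_{ij}d_i[x^i(t)-\bar x^k_d(t)]^\top\Gamma[x^i(t)-x^j(t)],\qquad \text{for each } e(i,j)\in\mathcal E \text{ with } i\in\mathcal C_k,\ k=1,\dots,K,$$ where $\bar x^k_d=\big(\sum_{i\in\mathcal C_k}d_i\big)^{-1}\sum_{i\in\mathcal C_k}d_ix^i$. Suppose that: (i) the common inter-cluster coupling condition holds; (ii) $\Gamma$ is symmetric and nonnegative definite; (iii) for some $\alpha\in\mathbb R$, each function $f_k(\cdot)-\alpha\Gamma\,\cdot$ $(k=1,\dots,K)$ satisfies the decreasing condition; (iv) there exist a constant $c>0$ and a positive definite diagonal matrix $\hat D=\mathrm{diag}[\hat d_1,\dots,\hat d_m]$,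 with $\hat d=[\hat d_1,\dots,\hat d_m]^\top$, such that $[\hat D(cL+\alpha I_m)]^s|_{\mathcal T^{\hat d}_{\mathcal C}(1)}\le 0$; (v) the adaptive system is essentially bounded, i.e. its solutions $(x(t),w(t))$ exist for all $t\ge 0$ and are bounded. Then the adaptive system cluster synchronizes with respect to $\mathcal C$ for any initial data, i.e. for every solution, $\lim_{t\to\infty}[x^i(t)-x^j(t)]=0$ for all $i,j\in\mathcal C_k$ and all $k=1,\dots,K$.
   Context: Graph and clustering: "simple" means no self-loops or multiple edges; "bi-directed" means $e(i,j)\in\mathcal E$ if and only if $e(j,i)\in\mathcal E$. The adjacency matrix has $a_{ij}=1$ if $e(i,j)\in\mathcal E$ and $a_{ij}=0$ otherwise. $\mathcal N(i)=\{j\in\mathcal V: e(i,j)\in\mathcal E\}$ is the neighborhood of $i$. A clustering is a partition of $\mathcal V$: $\bigcup_{k=1}^K\mathcal C_k=\mathcal V$ and $\mathcal C_k\cap\mathcal C_l=\emptyset$ for $k\neq l$. Put $\mathcal N_{k}(i)=\mathcal N(i)\cap\mathcal C_{k}$ and $d_{i,k}=\#\mathcal N_k(i)$. The weights $w_{ij}$ and $w_{ji}$ are not required to be equal. Weighted Laplacian $L$: for $i\ne j$, $l_{ij}=1/d_{i,k}$ if $j\in\mathcal N_k(i)$ for some $k\in\{1,\dots,K\}$ (this $k$ is the index of the cluster containing $j$), and $l_{ij}=0$ otherwise; $l_{ii}=-\sum_{j\ne i}l_{ij}$. Since $\mathcal G$ is connected, $L$ is irreducible, so a left eigenvector for the eigenvalue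 $0$ with all entries positive exists. Common inter-cluster coupling condition: for $i\in\mathcal C_k$ let $\mathcal L_k^i=\{k': k'\ne k,\ \mathcal N_{k'}(i)\neq\emptyset\}$. The condition is that for every $k=1,\dots,K$, $\mathcal L_k^i=\mathcal L_k^{i'}$ for all $i,i'\in\mathcal C_k$. Decreasing condition for $f_k(\cdot)-\alpha\Gamma\,\cdot$: there exists $\delta>0$ such that $(\xi-\zeta)^\top[f_k(\xi)-f_k(\zeta)-\alpha\Gamma(\xi-\zeta)]\le-\delta(\xi-\zeta)^\top(\xi-\zeta)$ for all $\xi,\zeta\in\mathbb R^n$. Transverse space: for a vector $v$ with positive entries $v_1,\dots,v_m$, $\mathcal T^v_{\mathcal C}(1)=\{u=[u^1,\dots,u^m]^\top\in\mathbb R^m:\ \sum_{i\in\mathcal C_k}v_iu^i=0\ \text{for all }k=1,\dots,K\}$. Matrix notation: $Z^s=(Z+Z^\top)/2$, $I_m$ is the identity matrix, and $Z|_V\le 0$ means $u^\top Zu\le 0$ for all $u$ in the linear subspace $V$. Standing assumption: the functions $f_k$ of different clusters are assumed so different that trajectories in different clusters do not approach each other; under this assumption cluster synchronization means the convergence stated in the claim. *)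

theory Defs
  imports "HOL-Analysis.Analysis"
begin

section \<open>Graph, clustering and weighted Laplacian\<close>

text \<open>
  The vertex set is the finite type \<open>'m\<close> and the cluster indices are the finite type \<open>'k\<close>.
  A simple directed graph is given by its edge relation, so multiple edges cannot occur.
\<close>

definition simple_bidirected_graph :: "('m \<times> 'm) set \<Rightarrow> bool" where
  "simple_bidirected_graph E \<longleftrightarrow> irrefl E \<and> sym E"

definition connected_graph :: "('m \<times> 'm) set \<Rightarrow> bool" where
  "connected_graph E \<longleftrightarrow> (\<forall>i j. (i, j) \<in> E\<^sup>*)"

definition adjacency :: "('m::finite \<times> 'm) set \<Rightarrow> real ^ 'm ^ 'm" where
  "adjacency E = (\<chi> i j. if (i, j) \<in> E then 1 else 0)"

definition is_clustering :: "('k::finite \<Rightarrow> 'm set) \<Rightarrow> bool" where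
  "is_clustering C \<longleftrightarrow> (\<Union>k. C k) = UNIV \<and> disjoint_family C"

definition neighbourhood :: "('m \<times> 'm) set \<Rightarrow> 'm \<Rightarrow> 'm set" where
  "neighbourhood E i = {j. (i, j) \<in> E}"

definition cluster_neighbourhood ::
  "('m \<times> 'm) set \<Rightarrow> ('k \<Rightarrow> 'm set) \<Rightarrow> 'k \<Rightarrow> 'm \<Rightarrow> 'm set" where
  "cluster_neighbourhood E C k i = neighbourhood E i \<inter> C k"

definition cluster_degree ::
  "('m \<times> 'm) set \<Rightarrow> ('k \<Rightarrow> 'm set) \<Rightarrow> 'm \<Rightarrow> 'k \<Rightarrow> nat" where
  "cluster_degree E C i k = card (cluster_neighbourhood E C k i)"

definition laplacian_offdiag ::
  "('m \<times> 'm) set \<Rightarrow> ('k \<Rightarrow> 'm set) \<Rightarrow> 'm \<Rightarrow> 'm \<Rightarrow> real" where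
  "laplacian_offdiag E C i j =
     (if \<exists>k. j \<in> cluster_neighbourhood E C k i
      then 1 / real (cluster_degree E C i (THE k. j \<in> cluster_neighbourhood E C k i))
      else 0)"

definition weighted_laplacian ::
  "('m::finite \<times> 'm) set \<Rightarrow> ('k \<Rightarrow> 'm set) \<Rightarrow> real ^ 'm ^ 'm" where
  "weighted_laplacian E C =
     (\<chi> i j. if i = j then - (\<Sum>j'\<in>UNIV - {i}. laplacian_offdiag E C i j')
             else laplacian_offdiag E C i j)"

definition linked_clusters ::
  "('m \<times> 'm) set \<Rightarrow> ('k \<Rightarrow> 'm set) \<Rightarrow> 'k \<Rightarrow> 'm \<Rightarrow> 'k set" where
  "linked_clusters E C k i = {k'. k' \<noteq> k \<and> cluster_neighbourhood E C k' i \<noteq> {}}"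

definition common_intercluster_coupling ::
  "('m \<times> 'm) set \<Rightarrow> ('k \<Rightarrow> 'm set) \<Rightarrow> bool" where
  "common_intercluster_coupling E C \<longleftrightarrow>
     (\<forall>k. \<forall>i\<in>C k. \<forall>i'\<in>C k. linked_clusters E C k i = linked_clusters E C k i')"

section \<open>Matrices\<close>

definition left_eigenvector :: "real ^ 'm ^ 'm \<Rightarrow> real \<Rightarrow> real ^ 'm \<Rightarrow> bool" where
  "left_eigenvector A l v \<longleftrightarrow> v \<noteq> 0 \<and> v v* A = l *\<^sub>R v"

definition sym_part :: "real ^ 'm ^ 'm \<Rightarrow> real ^ 'm ^ 'm" where
  "sym_part Z = (1 / 2) *\<^sub>R (Z + transpose Z)"

definition nonneg_definite :: "real ^ 'm ^ 'm \<Rightarrow> bool" where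
  "nonneg_definite Z \<longleftrightarrow> (\<forall>u. 0 \<le> u \<bullet> (Z *v u))"

definition pos_definite :: "real ^ 'm ^ 'm \<Rightarrow> bool" where
  "pos_definite Z \<longleftrightarrow> (\<forall>u. u \<noteq> 0 \<longrightarrow> 0 < u \<bullet> (Z *v u))"

definition nonpos_on :: "real ^ 'm ^ 'm \<Rightarrow> (real ^ 'm) set \<Rightarrow> bool" where
  "nonpos_on Z V \<longleftrightarrow> (\<forall>u\<in>V. u \<bullet> (Z *v u) \<le> 0)"

definition diag_matrix :: "real ^ 'm \<Rightarrow> real ^ 'm ^ 'm" where
  "diag_matrix v = (\<chi> i j. if i = j then v $ i else 0)"

definition transverse_space :: "('k \<Rightarrow> 'm set) \<Rightarrow> real ^ 'm \<Rightarrow> (real ^ 'm) set" where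
  "transverse_space C v = {u. \<forall>k. (\<Sum>i\<in>C k. v $ i * u $ i) = 0}"

text \<open>The decreasing condition for the map \<open>\<xi> \<mapsto> f \<xi> - A \<xi>\<close>.\<close>

definition decreasing_condition ::
  "(real ^ 'n \<Rightarrow> real ^ 'n) \<Rightarrow> real ^ 'n ^ 'n \<Rightarrow> bool" where
  "decreasing_condition f A \<longleftrightarrow>
     (\<exists>\<delta>>0. \<forall>\<xi> \<zeta>. (\<xi> - \<zeta>) \<bullet> (f \<xi> - f \<zeta> - A *v (\<xi> - \<zeta>)) \<le> - \<delta> * ((\<xi> - \<zeta>) \<bullet> (\<xi> - \<zeta>)))"

section \<open>The adaptive system\<close>

text \<open>
  A state is an \<open>m\<close>-tuple of vectors in \<open>n\<close>-space together with a matrix of weights, of which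
  only the entries on edges are meaningful.
\<close>

definition cluster_mean ::
  "('k \<Rightarrow> 'm set) \<Rightarrow> real ^ 'm \<Rightarrow> 'k \<Rightarrow> real ^ 'n ^ 'm \<Rightarrow> real ^ 'n" where
  "cluster_mean C d k x = inverse (\<Sum>i\<in>C k. d $ i) *\<^sub>R (\<Sum>i\<in>C k. d $ i *\<^sub>R x $ i)"

definition adaptive_solution ::
  "('m::finite \<times> 'm) set \<Rightarrow> ('k \<Rightarrow> 'm set) \<Rightarrow> ('k \<Rightarrow> real ^ 'n \<Rightarrow> real ^ 'n) \<Rightarrow> real ^ 'n ^ 'n \<Rightarrow>
   real ^ 'm \<Rightarrow> ('m \<Rightarrow> 'm \<Rightarrow> real) \<Rightarrow> real set \<Rightarrow>
   (real \<Rightarrow> real ^ 'n ^ 'm) \<Rightarrow> (real \<Rightarrow> real ^ 'm ^ 'm) \<Rightarrow> bool" where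
  "adaptive_solution E C f \<Gamma> d \<rho> J x w \<longleftrightarrow>
     (\<forall>k. \<forall>i\<in>C k. \<forall>t\<in>J.
        ((\<lambda>s. x s $ i) has_vector_derivative
           (f k (x t $ i) +
            (\<Sum>j\<in>UNIV. (adjacency E $ i $ j * w t $ i $ j) *\<^sub>R (\<Gamma> *v (x t $ j - x t $ i)))))
          (at t within J)) \<and>
     (\<forall>k. \<forall>i\<in>C k. \<forall>j. (i, j) \<in> E \<longrightarrow> (\<forall>t\<in>J.
        ((\<lambda>s. w s $ i $ j) has_real_derivative
           (\<rho> i j * d $ i *
            ((x t $ i - cluster_mean C d k (x t)) \<bullet> (\<Gamma> *v (x t $ i - x t $ j)))))
          (at t within J)))"

text \<open>
  Solutions exist for all times iff every solution on a finite interval \<open>[0, T)\<close> extends to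
  \<open>[0, \<infinity>)\<close>.  (Local existence for arbitrary initial data is Peano's theorem, the right-hand
  sides being continuous.)
\<close>

definition essentially_bounded ::
  "('m::finite \<times> 'm) set \<Rightarrow> ('k \<Rightarrow> 'm set) \<Rightarrow> ('k \<Rightarrow> real ^ 'n \<Rightarrow> real ^ 'n) \<Rightarrow> real ^ 'n ^ 'n \<Rightarrow>
   real ^ 'm \<Rightarrow> ('m \<Rightarrow> 'm \<Rightarrow> real) \<Rightarrow> bool" where
  "essentially_bounded E C f \<Gamma> d \<rho> \<longleftrightarrow>
     (\<forall>T>0. \<forall>x w. adaptive_solution E C f \<Gamma> d \<rho> {0..<T} x w \<longrightarrow>
        (\<exists>x' w'. adaptive_solution E C f \<Gamma> d \<rho> {0..} x' w' \<and>
           (\<forall>t\<in>{0..<T}. x' t = x t \<and> (\<forall>(i, j)\<in>E. w' t $ i $ j = w t $ i $ j)))) \<and>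
     (\<forall>x w. adaptive_solution E C f \<Gamma> d \<rho> {0..} x w \<longrightarrow>
        bounded (x ` {0..}) \<and> (\<forall>(i, j)\<in>E. bounded ((\<lambda>t. w t $ i $ j) ` {0..})))"

definition cluster_synchronizes ::
  "('m::finite \<times> 'm) set \<Rightarrow> ('k \<Rightarrow> 'm set) \<Rightarrow> ('k \<Rightarrow> real ^ 'n \<Rightarrow> real ^ 'n) \<Rightarrow> real ^ 'n ^ 'n \<Rightarrow>
   real ^ 'm \<Rightarrow> ('m \<Rightarrow> 'm \<Rightarrow> real) \<Rightarrow> bool" where
  "cluster_synchronizes E C f \<Gamma> d \<rho> \<longleftrightarrow>
     (\<forall>x w. adaptive_solution E C f \<Gamma> d \<rho> {0..} x w \<longrightarrow>
        (\<forall>k. \<forall>i\<in>C k. \<forall>j\<in>C k. ((\<lambda>t. x t $ i - x t $ j) \<longlongrightarrow> 0) at_top))"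

end

theory Submission
  imports Defs
begin

text \<open>
  Write \<open>y\<^sub>i\<close> for the deviation of \<open>x\<^sub>i\<close> from the weighted mean of its cluster and
  \<open>a\<^sub>i\<^sub>j\<close> for the off-diagonal entries of the Laplacian.  The weight dynamics are the gradient-like
  law that makes
  \<open>Q = (1/2) \<Sum>\<^sub>i d\<^sub>i |y\<^sub>i|\<^sup>2 + \<Sum>\<^sub>i\<^sub>j (w\<^sub>i\<^sub>j - \<kappa> a\<^sub>i\<^sub>j)\<^sup>2 / (2 \<rho>\<^sub>i\<^sub>j)\<close>
  (second sum over the edges) a Lyapunov function: along a solution, the unknown weights cancel from
  the derivative of \<open>Q\<close>, as if they were held constant at the values \<open>\<kappa> a\<^sub>i\<^sub>j\<close>.

  With these constant weights, three facts about the graph are used.  First, common inter-cluster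
  coupling makes the part of \<open>\<Sum>\<^sub>j a\<^sub>i\<^sub>j (x\<^sub>j - x\<^sub>i)\<close> that comes from the cluster means the same for
  all vertices of a cluster, and such cluster-wise constant terms are orthogonal to the deviations
  (\<open>intercluster_drift\<close>, \<open>deviation_orthogonal\<close>).  Secondly, \<open>d L = 0\<close> says that the edge weights
  \<open>d\<^sub>i a\<^sub>i\<^sub>j\<close> have equal inflow and outflow at each vertex, so what is left of the coupling is minus one
  half of the energy \<open>\<Sum>\<^sub>i\<^sub>j d\<^sub>i a\<^sub>i\<^sub>j q(y\<^sub>i - y\<^sub>j)\<close>, where \<open>q(v) = v \<bullet> \<Gamma> v\<close>
  (\<open>laplacian_coupling_dissipation\<close>).  Thirdly, since the graph is connected and the deviations are
  centred, this energy controls \<open>\<Sum>\<^sub>i d\<^sub>i q(y\<^sub>i)\<close> (\<open>poincare_inequality\<close>).  The constant \<open>\<kappa>\<close> occurs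
  only in the Lyapunov function and may therefore be chosen so large that the coupling
  absorbs the term \<open>\<alpha> \<Sum>\<^sub>i d\<^sub>i q(y\<^sub>i)\<close> left by the decreasing condition.  This gives
  \<open>Q' \<le> - \<delta> V\<close> with \<open>V = \<Sum>\<^sub>i d\<^sub>i |y\<^sub>i|\<^sup>2\<close> (\<open>lyapunov_dissipation\<close>).

  So \<open>V\<close> is integrable over the half line.  As the solution is bounded, \<open>V\<close> has bounded derivative, and
  an integrable nonnegative function with bounded derivative tends to zero
  (\<open>dissipated_tendsto_zero\<close>).  Hence all deviations vanish in the limit.
\<close>

section \<open>Semi-inner products on families indexed by the vertices\<close>

text \<open>
  The form \<open>u \<bullet> \<Gamma> v\<close> may be degenerate, so it does not make the state space an inner product space.
  Symmetry and nonnegativity are what replaces the norm below.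
\<close>
locale semi_inner_product =
  fixes B :: "'a::real_vector \<Rightarrow> 'a \<Rightarrow> real"
  assumes bilinear: "bilinear B"
    and sym: "B u v = B v u"
    and nonneg: "0 \<le> B v v"
begin

lemma diff_diff: "B (u - v) (u - v) = B u u - 2 * B u v + B v v"
  using sym[of u v] by (simp add: bilinear_lsub[OF bilinear] bilinear_rsub[OF bilinear])

text \<open>
  Replaces the triangle inequality of a norm: the form is nonnegative at \<open>u - v\<close>.
\<close>
lemma add_add_le: "B (u + v) (u + v) \<le> 2 * B u u + 2 * B v v"
  using nonneg[of "u - v"] sym[of u v]
  by (simp add: diff_diff bilinear_ladd[OF bilinear] bilinear_radd[OF bilinear])

lemma sum_right: "B u (\<Sum>j\<in>S. r j *\<^sub>R v j) = (\<Sum>j\<in>S. r j * B u (v j))"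
proof -
  have lin: "linear (B u)"
    using bilinear by (simp add: bilinear_def)
  show ?thesis
    by (simp add: linear_sum[OF lin] linear_cmul[OF lin])
qed

text \<open>
  Expanding \<open>B (y i - y j) (y i - y j)\<close> gives two square terms and a cross term.  Balance of the weights
  turns the sum over the squares at \<open>j\<close> into the one over the squares at \<open>i\<close>.
\<close>
lemma energy_identity:
  fixes g :: "'m::finite \<Rightarrow> 'm \<Rightarrow> real"
  assumes balanced: "\<And>j. (\<Sum>i\<in>UNIV. g i j) = (\<Sum>i\<in>UNIV. g j i)"
  shows "(\<Sum>i\<in>UNIV. \<Sum>j\<in>UNIV. g i j * B (y i) (y j - y i)) =
    - (\<Sum>i\<in>UNIV. \<Sum>j\<in>UNIV. g i j * B (y i - y j) (y i - y j)) / 2"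
proof -
  have "(\<Sum>i\<in>UNIV. \<Sum>j\<in>UNIV. g i j * B (y j) (y j)) = (\<Sum>j\<in>UNIV. (\<Sum>i\<in>UNIV. g i j) * B (y j) (y j))"
    by (subst sum.swap) (simp add: sum_distrib_right)
  also have "\<dots> = (\<Sum>i\<in>UNIV. \<Sum>j\<in>UNIV. g i j * B (y i) (y i))"
    by (simp add: balanced sum_distrib_right)
  finally have swap: "(\<Sum>i\<in>UNIV. \<Sum>j\<in>UNIV. g i j * B (y j) (y j)) =
      (\<Sum>i\<in>UNIV. \<Sum>j\<in>UNIV. g i j * B (y i) (y i))" .
  have "(\<Sum>i\<in>UNIV. \<Sum>j\<in>UNIV. g i j * B (y i - y j) (y i - y j)) =
      (\<Sum>i\<in>UNIV. \<Sum>j\<in>UNIV. - 2 * (g i j * B (y i) (y j - y i))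
        + (g i j * B (y j) (y j) - g i j * B (y i) (y i)))"
    unfolding diff_diff unfolding bilinear_rsub[OF bilinear] by (intro sum.cong refl) (simp add: algebra_simps)
  also have "\<dots> = - 2 * (\<Sum>i\<in>UNIV. \<Sum>j\<in>UNIV. g i j * B (y i) (y j - y i))"
    by (simp only: sum.distrib sum_subtractf swap diff_self add_0_right flip: sum_distrib_left)
  finally show ?thesis
    by simp
qed

text \<open>
  Extending a path by an edge at most doubles the bound and adds a multiple of the energy for the new edge.
  The constant is exponential in the length of the path, but depends only on the graph and the weights.
\<close>
lemma difference_bound_along_path:
  fixes g :: "'m::finite \<Rightarrow> 'm \<Rightarrow> real"
  assumes g: "\<And>i j. 0 \<le> g i j" "\<And>i j. (i, j) \<in> E \<Longrightarrow> 0 < g i j"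
    and path: "(a, b) \<in> E\<^sup>*"
  shows "\<exists>P. \<forall>y. B (y a - y b) (y a - y b) \<le>
    P * (\<Sum>i\<in>UNIV. \<Sum>j\<in>UNIV. g i j * B (y i - y j) (y i - y j))"
  using path
proof (induction rule: rtrancl_induct)
  case base
  have "B 0 0 = 0"
    using bilinear_lzero[OF bilinear] by blast
  then show ?case
    by (intro exI[of _ 0]) simp
next
  case (step b e)
  then obtain P where P: "\<And>y. B (y a - y b) (y a - y b) \<le>
      P * (\<Sum>i\<in>UNIV. \<Sum>j\<in>UNIV. g i j * B (y i - y j) (y i - y j))"
    by blast
  have gpos: "0 < g b e"
    using g(2) step by blast
  show ?case
  proof (intro exI[of _ "2 * P + 2 / g b e"] allI)
    fix y
    let ?S = "\<Sum>i\<in>UNIV. \<Sum>j\<in>UNIV. g i j * B (y i - y j) (y i - y j)"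
    have "g b e * B (y b - y e) (y b - y e) \<le> (\<Sum>j\<in>UNIV. g b j * B (y b - y j) (y b - y j))"
      using member_le_sum[of e UNIV "\<lambda>j. g b j * B (y b - y j) (y b - y j)"] g(1) nonneg by simp
    also have "\<dots> \<le> ?S"
      using member_le_sum[of b UNIV "\<lambda>i. \<Sum>j\<in>UNIV. g i j * B (y i - y j) (y i - y j)"] g(1) nonneg
      by (simp add: sum_nonneg)
    finally have edge: "B (y b - y e) (y b - y e) \<le> ?S / g b e"
      using gpos by (simp only: pos_le_divide_eq mult.commute)
    have "B (y a - y e) (y a - y e) \<le>
        2 * B (y a - y b) (y a - y b) + 2 * B (y b - y e) (y b - y e)"
      using add_add_le[of "y a - y b" "y b - y e"] by simp
    also have "\<dots> \<le> 2 * (P * ?S) + 2 * (?S / g b e)"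
      using P[of y] edge by linarith
    finally show "B (y a - y e) (y a - y e) \<le> (2 * P + 2 / g b e) * ?S"
      by (simp only: ring_distribs mult.assoc times_divide_eq_left times_divide_eq_right mult_1)
  qed
qed

text \<open>
  In the weighted average over \<open>j\<close> of the squares of \<open>y i - y j\<close>, the cross terms add up to zero because the family
  is centred, and the squares of the \<open>y j\<close> can be dropped.
\<close>
lemma centred_le_sum_differences:
  fixes p :: "'m \<Rightarrow> real"
  assumes "finite S" "i \<in> S" "\<And>j. j \<in> S \<Longrightarrow> 0 < p j"
    and centred: "(\<Sum>j\<in>S. p j *\<^sub>R y j) = 0"
  shows "B (y i) (y i) \<le> (\<Sum>j\<in>S. B (y i - y j) (y i - y j))"
proof -
  have cross: "(\<Sum>j\<in>S. p j * B (y i) (y j)) = 0"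
    using centred bilinear_rzero[OF bilinear] by (simp flip: sum_right)
  have "(\<Sum>j\<in>S. p j) * B (y i) (y i) \<le> (\<Sum>j\<in>S. p j * B (y i) (y i)) + (\<Sum>j\<in>S. p j * B (y j) (y j))"
    using assms(3) by (simp add: sum_distrib_right sum_nonneg nonneg order_less_imp_le)
  also have "\<dots> = (\<Sum>j\<in>S. p j * B (y i - y j) (y i - y j)) + 2 * (\<Sum>j\<in>S. p j * B (y i) (y j))"
    unfolding sum_distrib_left sum.distrib[symmetric]
    by (intro sum.cong refl) (simp add: diff_diff algebra_simps)
  also have "\<dots> = (\<Sum>j\<in>S. p j * B (y i - y j) (y i - y j))"
    by (simp add: cross)
  also have "\<dots> \<le> (\<Sum>j\<in>S. (\<Sum>l\<in>S. p l) * B (y i - y j) (y i - y j))"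
    using assms by (intro sum_mono mult_right_mono member_le_sum nonneg) (auto intro: less_imp_le)
  finally have "(\<Sum>j\<in>S. p j) * B (y i) (y i) \<le> (\<Sum>j\<in>S. p j) * (\<Sum>j\<in>S. B (y i - y j) (y i - y j))"
    by (simp add: sum_distrib_left)
  moreover have "0 < (\<Sum>j\<in>S. p j)"
    using assms by (intro sum_pos) auto
  ultimately show ?thesis
    by simp
qed

text \<open>
  A centred vector is controlled by differences within its cluster, and these by the differences
  along edges.  The connecting paths may leave the cluster.
\<close>
lemma poincare_inequality:
  fixes g :: "'m::finite \<Rightarrow> 'm \<Rightarrow> real" and p :: "'m \<Rightarrow> real"
  assumes g: "\<And>i j. 0 \<le> g i j" "\<And>i j. (i, j) \<in> E \<Longrightarrow> 0 < g i j"
    and "connected_graph E"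
    and p: "\<And>i. 0 < p i"
    and cover: "(\<Union>k. C k) = UNIV"
  obtains P where "0 \<le> P"
    and "\<And>y. (\<And>k. (\<Sum>i\<in>C k. p i *\<^sub>R y i) = 0) \<Longrightarrow> (\<Sum>i\<in>UNIV. p i * B (y i) (y i)) \<le>
      P * (\<Sum>i\<in>UNIV. \<Sum>j\<in>UNIV. g i j * B (y i - y j) (y i - y j))"
proof -
  have "\<exists>P. \<forall>y. B (y a - y b) (y a - y b) \<le>
      P * (\<Sum>i\<in>UNIV. \<Sum>j\<in>UNIV. g i j * B (y i - y j) (y i - y j))" for a b
  proof (rule difference_bound_along_path)
    show "(a, b) \<in> E\<^sup>*"
      using assms(3) by (simp add: connected_graph_def)
  qed (use g in auto)
  then have "\<forall>ab. \<exists>P. \<forall>y. B (y (fst ab) - y (snd ab)) (y (fst ab) - y (snd ab)) \<le>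
      P * (\<Sum>i\<in>UNIV. \<Sum>j\<in>UNIV. g i j * B (y i - y j) (y i - y j))"
    by simp
  from choice[OF this] obtain R where R: "\<And>a b y. B (y a - y b) (y a - y b) \<le>
      R (a, b) * (\<Sum>i\<in>UNIV. \<Sum>j\<in>UNIV. g i j * B (y i - y j) (y i - y j))"
    by auto
  show thesis
  proof (rule that[of "\<Sum>i\<in>UNIV. \<Sum>j\<in>UNIV. p i * \<bar>R (i, j)\<bar>"])
    show "0 \<le> (\<Sum>i\<in>UNIV. \<Sum>j\<in>UNIV. p i * \<bar>R (i, j)\<bar>)"
      using p by (intro sum_nonneg mult_nonneg_nonneg) (auto intro: less_imp_le)
    fix y :: "'m \<Rightarrow> 'a"
    assume centred: "\<And>k. (\<Sum>i\<in>C k. p i *\<^sub>R y i) = 0"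
    let ?S = "\<Sum>i\<in>UNIV. \<Sum>j\<in>UNIV. g i j * B (y i - y j) (y i - y j)"
    have S: "0 \<le> ?S"
      by (intro sum_nonneg mult_nonneg_nonneg g nonneg)
    have "B (y i) (y i) \<le> (\<Sum>j\<in>UNIV. \<bar>R (i, j)\<bar> * ?S)" for i
    proof -
      obtain k where "i \<in> C k"
        using cover by blast
      then have "B (y i) (y i) \<le> (\<Sum>j\<in>C k. B (y i - y j) (y i - y j))"
        using centred p by (intro centred_le_sum_differences[where p = p]) auto
      also have "\<dots> \<le> (\<Sum>j\<in>UNIV. B (y i - y j) (y i - y j))"
        by (intro sum_mono2) (auto intro: nonneg)
      also have "\<dots> \<le> (\<Sum>j\<in>UNIV. \<bar>R (i, j)\<bar> * ?S)"
      proof (rule sum_mono)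
        fix j
        show "B (y i - y j) (y i - y j) \<le> \<bar>R (i, j)\<bar> * ?S"
          using R[of y i j] mult_right_mono[OF abs_ge_self[of "R (i, j)"] S] by (rule order_trans)
      qed
      finally show ?thesis .
    qed
    then have "(\<Sum>i\<in>UNIV. p i * B (y i) (y i)) \<le> (\<Sum>i\<in>UNIV. p i * (\<Sum>j\<in>UNIV. \<bar>R (i, j)\<bar> * ?S))"
      by (intro sum_mono mult_left_mono) (auto intro: less_imp_le p)
    also have "\<dots> = (\<Sum>i\<in>UNIV. \<Sum>j\<in>UNIV. p i * \<bar>R (i, j)\<bar>) * ?S"
      unfolding sum_distrib_right sum_distrib_left[of "p _"] mult.assoc ..
    finally show "(\<Sum>i\<in>UNIV. p i * B (y i) (y i)) \<le> \<dots>" .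
  qed
qed

end

section \<open>The weighted Laplacian\<close>

definition cluster_of :: "('k \<Rightarrow> 'm set) \<Rightarrow> 'm \<Rightarrow> 'k" where
  "cluster_of C i = (THE k. i \<in> C k)"

lemma mem_cluster_iff:
  fixes C :: "'k::finite \<Rightarrow> 'm set"
  assumes "is_clustering C"
  shows "i \<in> C k \<longleftrightarrow> cluster_of C i = k"
proof -
  have "\<exists>!k. i \<in> C k"
    using assms unfolding is_clustering_def disjoint_family_on_def by blast
  then show ?thesis
    unfolding cluster_of_def by (metis (mono_tags, lifting) theI')
qed

lemma sum_by_cluster:
  fixes C :: "'k::finite \<Rightarrow> 'm::finite set"
  assumes "is_clustering C"
  shows "(\<Sum>i\<in>UNIV. h i) = (\<Sum>k\<in>UNIV. \<Sum>i\<in>C k. h i)"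
  using sum.group[of UNIV UNIV "cluster_of C" h] by (simp add: flip: mem_cluster_iff[OF assms])

lemma laplacian_offdiag_eq:
  fixes C :: "'k::finite \<Rightarrow> 'm::finite set"
  assumes "is_clustering C"
  shows "laplacian_offdiag E C i j =
    (if (i, j) \<in> E then 1 / real (card (cluster_neighbourhood E C (cluster_of C j) i)) else 0)"
  unfolding laplacian_offdiag_def cluster_degree_def cluster_neighbourhood_def neighbourhood_def
  by (auto simp: mem_cluster_iff[OF assms])

lemma laplacian_offdiag_pos:
  fixes C :: "'k::finite \<Rightarrow> 'm::finite set"
  assumes "is_clustering C" "(i, j) \<in> E"
  shows "0 < laplacian_offdiag E C i j"
proof -
  have "j \<in> cluster_neighbourhood E C (cluster_of C j) i"
    using assms by (simp add: cluster_neighbourhood_def neighbourhood_def mem_cluster_iff)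
  then show ?thesis
    using assms by (auto simp: laplacian_offdiag_eq card_gt_0_iff)
qed

lemma laplacian_offdiag_nonneg:
  fixes C :: "'k::finite \<Rightarrow> 'm::finite set"
  assumes "is_clustering C"
  shows "0 \<le> laplacian_offdiag E C i j"
  by (simp add: laplacian_offdiag_eq[OF assms])

text \<open>
  The equation at column \<open>j\<close> of \<open>d L = 0\<close>, in which the diagonal entry is minus the sum of row \<open>j\<close>.
\<close>
lemma laplacian_balanced:
  fixes C :: "'k::finite \<Rightarrow> 'm::finite set"
  assumes "is_clustering C" "irrefl E" "left_eigenvector (weighted_laplacian E C) 0 d"
  shows "(\<Sum>i\<in>UNIV. d $ i * laplacian_offdiag E C i j) = (\<Sum>i\<in>UNIV. d $ j * laplacian_offdiag E C j i)"
proof -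
  have diag: "laplacian_offdiag E C i i = 0" for i
    using assms by (simp add: laplacian_offdiag_eq irrefl_def)
  have "0 = (\<Sum>i\<in>UNIV. d $ i * weighted_laplacian E C $ i $ j)"
    using assms(3) by (simp add: left_eigenvector_def vector_matrix_mult_def vec_eq_iff mult.commute)
  also have "\<dots> = d $ j * weighted_laplacian E C $ j $ j +
      (\<Sum>i\<in>UNIV - {j}. d $ i * weighted_laplacian E C $ i $ j)"
    by (simp add: sum.remove[of UNIV j])
  also have "(\<Sum>i\<in>UNIV - {j}. d $ i * weighted_laplacian E C $ i $ j) =
      (\<Sum>i\<in>UNIV - {j}. d $ i * laplacian_offdiag E C i j)"
    by (intro sum.cong) (auto simp: weighted_laplacian_def)
  also have "\<dots> = (\<Sum>i\<in>UNIV. d $ i * laplacian_offdiag E C i j)"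
    by (simp add: sum.remove[of UNIV j] diag)
  also have "weighted_laplacian E C $ j $ j = - (\<Sum>i\<in>UNIV. laplacian_offdiag E C j i)"
    by (simp add: weighted_laplacian_def sum.remove[of UNIV j] diag)
  finally show ?thesis
    by (simp add: sum_distrib_left)
qed

text \<open>
  The normalization by the number of neighbours in the cluster lets a cluster act
  with total weight one on each vertex that has a neighbour in it.
\<close>
lemma laplacian_cluster_sum:
  fixes C :: "'k::finite \<Rightarrow> 'm::finite set"
  assumes "is_clustering C" "k \<noteq> cluster_of C i"
  shows "(\<Sum>j\<in>C k. laplacian_offdiag E C i j) =
    (if k \<in> linked_clusters E C (cluster_of C i) i then 1 else 0)"
proof -
  let ?N = "cluster_neighbourhood E C k i"
  have N: "?N \<subseteq> C k"
    by (auto simp: cluster_neighbourhood_def)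
  have "(\<Sum>j\<in>C k. laplacian_offdiag E C i j) = (\<Sum>j\<in>C k. if j \<in> ?N then 1 / real (card ?N) else 0)"
    using assms by (intro sum.cong)
      (auto simp: laplacian_offdiag_eq mem_cluster_iff cluster_neighbourhood_def neighbourhood_def)
  also have "\<dots> = (\<Sum>j\<in>?N. 1 / real (card ?N))"
    using N by (simp add: Int_absorb1 flip: sum.inter_restrict)
  also have "\<dots> = (if ?N \<noteq> {} then 1 else 0)"
    by simp
  finally show ?thesis
    using assms(2) by (simp add: linked_clusters_def)
qed

text \<open>
  If every vertex sits at the value \<open>z\<close> of its cluster, the coupling term at \<open>i\<close> depends only on
  the set of clusters linked to \<open>i\<close>, which all vertices of one cluster share.
\<close>
lemma intercluster_drift:
  fixes C :: "'k::finite \<Rightarrow> 'm::finite set" and z :: "'k \<Rightarrow> 'a::real_vector"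
  assumes cl: "is_clustering C" and "common_intercluster_coupling E C"
  obtains v where "\<And>i. (\<Sum>j\<in>UNIV. laplacian_offdiag E C i j *\<^sub>R (z (cluster_of C j) - z (cluster_of C i)))
    = v (cluster_of C i)"
proof -
  let ?drift = "\<lambda>k i. \<Sum>k'\<in>linked_clusters E C k i. z k' - z k"
  have eq: "(\<Sum>j\<in>UNIV. laplacian_offdiag E C i j *\<^sub>R (z (cluster_of C j) - z (cluster_of C i)))
      = ?drift (cluster_of C i) i" for i
  proof -
    let ?k = "cluster_of C i"
    have "(\<Sum>j\<in>UNIV. laplacian_offdiag E C i j *\<^sub>R (z (cluster_of C j) - z ?k)) =
        (\<Sum>k\<in>UNIV. \<Sum>j\<in>C k. laplacian_offdiag E C i j *\<^sub>R (z k - z ?k))"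
      unfolding sum_by_cluster[OF cl] by (intro sum.cong) (auto simp: mem_cluster_iff[OF cl])
    also have "\<dots> = (\<Sum>k\<in>UNIV. (\<Sum>j\<in>C k. laplacian_offdiag E C i j) *\<^sub>R (z k - z ?k))"
      by (simp add: scaleR_sum_left)
    also have "\<dots> = (\<Sum>k\<in>UNIV. if k \<in> linked_clusters E C ?k i then z k - z ?k else 0)"
    proof (intro sum.cong refl)
      fix k
      show "(\<Sum>j\<in>C k. laplacian_offdiag E C i j) *\<^sub>R (z k - z ?k) =
          (if k \<in> linked_clusters E C ?k i then z k - z ?k else 0)"
        by (cases "k = ?k") (simp_all add: laplacian_cluster_sum[OF cl])
    qed
    also have "\<dots> = ?drift ?k i"
      by (simp flip: sum.inter_restrict)
    finally show ?thesis .
  qed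
  \<comment> \<open>The drift of a cluster is read off at an arbitrary representative.\<close>
  have "?drift (cluster_of C i) i = ?drift (cluster_of C i) (SOME i'. i' \<in> C (cluster_of C i))" for i
  proof -
    have i: "i \<in> C (cluster_of C i)"
      by (simp add: mem_cluster_iff[OF cl])
    then have "(SOME i'. i' \<in> C (cluster_of C i)) \<in> C (cluster_of C i)"
      by (rule someI)
    with i have "linked_clusters E C (cluster_of C i) i =
        linked_clusters E C (cluster_of C i) (SOME i'. i' \<in> C (cluster_of C i))"
      using assms(2) unfolding common_intercluster_coupling_def by blast
    then show ?thesis
      by simp
  qed
  then show thesis
    using that[of "\<lambda>k. ?drift k (SOME i'. i' \<in> C k)"] eq by presburger
qed

section \<open>A convergence criterion for dissipative quantities\<close>

text \<open>
  A variant of Barbalat's lemma.  Whenever \<open>V\<close> reaches \<open>\<epsilon>\<close>, the bound on its derivative keeps it above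
  \<open>\<epsilon>/2\<close> for a fixed length of time, during which \<open>Q\<close> loses a fixed amount.  A nonincreasing function
  that is bounded below cannot do so at arbitrarily late times.
\<close>
lemma dissipated_tendsto_zero:
  fixes Q V :: "real \<Rightarrow> real"
  assumes Q: "\<And>t. 0 \<le> t \<Longrightarrow> (Q has_real_derivative Q' t) (at t within {0..})"
    and V: "\<And>t. 0 \<le> t \<Longrightarrow> (V has_real_derivative V' t) (at t within {0..})"
    and Q_nonneg: "\<And>t. 0 \<le> t \<Longrightarrow> 0 \<le> Q t"
    and V_nonneg: "\<And>t. 0 \<le> t \<Longrightarrow> 0 \<le> V t"
    and "0 < \<delta>"
    and dissipation: "\<And>t. 0 \<le> t \<Longrightarrow> Q' t \<le> - \<delta> * V t"
    and V'_bounded: "\<And>t. 0 \<le> t \<Longrightarrow> \<bar>V' t\<bar> \<le> K"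
  shows "(V \<longlongrightarrow> 0) at_top"
proof -
  have mean_value: "\<exists>s\<in>{a..b}. F b - F a = F' s * (b - a)"
    if F: "\<And>t. 0 \<le> t \<Longrightarrow> (F has_real_derivative F' t) (at t within {0..})" and "0 \<le> a" "a \<le> b"
    for F F' :: "real \<Rightarrow> real" and a b
  proof (rule mvt_very_simple[OF \<open>a \<le> b\<close>])
    fix t assume "a \<le> t" "t \<le> b"
    then show "(F has_derivative (*) (F' t)) (at t within {a..b})"
      using F[of t] \<open>0 \<le> a\<close> unfolding has_field_derivative_def
      by (auto intro: has_derivative_subset)
  qed
  have Q_le: "Q b \<le> Q a" if ab: "0 \<le> a" "a \<le> b" for a b
  proof -
    obtain s where s: "s \<in> {a..b}" "Q b - Q a = Q' s * (b - a)"
      using mean_value[OF Q ab] by auto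
    have "Q' s \<le> 0"
    proof -
      have "0 \<le> s"
        using s(1) ab by simp
      then have "0 \<le> \<delta> * V s" "Q' s \<le> - \<delta> * V s"
        using dissipation[of s] V_nonneg[of s] \<open>0 < \<delta>\<close> by simp_all
      then show ?thesis
        by linarith
    qed
    then have "Q' s * (b - a) \<le> 0"
      using that by (simp add: mult_nonpos_nonneg)
    then show ?thesis
      using s(2) by simp
  qed
  have "eventually (\<lambda>t. V t < \<epsilon>) at_top" if "0 < \<epsilon>" for \<epsilon>
  proof -
    \<comment> \<open>\<open>V\<close> needs at least the time \<open>h\<close> to fall from \<open>\<epsilon>\<close> to \<open>\<epsilon>/2\<close>, and \<open>Q\<close> loses at least \<open>\<eta>\<close> meanwhile.
      Replacing \<open>K\<close> by \<open>max K 1\<close> avoids a division by zero.\<close>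
    define K' where "K' = max K 1"
    define h where "h = \<epsilon> / (2 * K')"
    define \<eta> where "\<eta> = \<delta> * (\<epsilon> / 2) * h"
    have pos: "0 < K'" "0 < h" "0 < \<eta>"
      using that \<open>0 < \<delta>\<close> by (auto simp: K'_def h_def \<eta>_def)
    define I where "I = (INF t\<in>{0..}. Q t)"
    have bdd: "bdd_below (Q ` {0..})"
      using Q_nonneg by (auto intro!: bdd_belowI[of _ 0])
    have "\<exists>t0\<in>{0..}. Q t0 < I + \<eta>"
      using cInf_lessD[of "Q ` {0..}" "I + \<eta>"] pos(3) by (auto simp: I_def)
    then obtain t0 where t0: "0 \<le> t0" "Q t0 < I + \<eta>"
      by auto
    have "V t < \<epsilon>" if "t0 \<le> t" for t
    proof (rule ccontr)
      assume "\<not> V t < \<epsilon>"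
      have "0 \<le> t"
        using t0 that by simp
      have large: "\<epsilon> / 2 \<le> V s" if st: "s \<in> {t..t + h}" for s
      proof -
        obtain r where r: "r \<in> {t..s}" "V s - V t = V' r * (s - t)"
          using mean_value[OF V, where a=t and b=s] st \<open>0 \<le> t\<close> by auto
        have "\<bar>V' r * (s - t)\<bar> \<le> K' * h"
          using V'_bounded[of r] r(1) st \<open>0 \<le> t\<close> unfolding abs_mult
          by (intro mult_mono) (auto simp: K'_def)
        also have "\<dots> = \<epsilon> / 2"
          using pos by (simp add: h_def)
        finally show ?thesis
          using r(2) \<open>\<not> V t < \<epsilon>\<close> by linarith
      qed
      obtain s where s: "s \<in> {t..t + h}" "Q (t + h) - Q t = Q' s * (t + h - t)"
        using mean_value[OF Q, where a=t and b="t+h"] \<open>0 \<le> t\<close> pos by auto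
      have "Q' s \<le> - \<delta> * (\<epsilon> / 2)"
      proof -
        have "\<delta> * (\<epsilon> / 2) \<le> \<delta> * V s"
          using large[OF s(1)] \<open>0 < \<delta>\<close> by (intro mult_left_mono) auto
        moreover have "Q' s \<le> - \<delta> * V s"
          using dissipation[of s] s(1) \<open>0 \<le> t\<close> by simp
        ultimately show ?thesis
          by linarith
      qed
      then have "Q' s * h \<le> - \<eta>"
        using mult_right_mono[of "Q' s" "- \<delta> * (\<epsilon> / 2)" h] pos by (simp add: \<eta>_def)
      then have "Q (t + h) \<le> Q t - \<eta>"
        using s(2) by simp
      also have "\<dots> < I"
        using Q_le[OF t0(1) \<open>t0 \<le> t\<close>] t0(2) by simp
      also have "I \<le> Q (t + h)"
        unfolding I_def using pos \<open>0 \<le> t\<close> by (intro cINF_lower bdd) auto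
      finally show False
        by simp
    qed
    then show ?thesis
      by (auto simp: eventually_at_top_linorder)
  qed
  moreover have "eventually (\<lambda>t. a < V t) at_top" if "a < 0" for a
  proof (rule eventually_mono[OF eventually_ge_at_top[of 0]])
    show "a < V t" if "0 \<le> t" for t
      using V_nonneg[OF that] \<open>a < 0\<close> by simp
  qed
  ultimately show ?thesis
    by (intro order_tendstoI)
qed

section \<open>Deviations from the cluster means\<close>

definition deviation :: "('k \<Rightarrow> 'm set) \<Rightarrow> real ^ 'm \<Rightarrow> real ^ 'n ^ 'm \<Rightarrow> 'm \<Rightarrow> real ^ 'n" where
  "deviation C d x i = x $ i - cluster_mean C d (cluster_of C i) x"

lemma deviation_centred:
  fixes C :: "'k::finite \<Rightarrow> 'm::finite set"
  assumes "is_clustering C" "\<And>i. 0 < d $ i"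
  shows "(\<Sum>i\<in>C k. d $ i *\<^sub>R deviation C d x i) = 0"
proof (cases "C k = {}")
  case False
  then have "(\<Sum>i\<in>C k. d $ i) \<noteq> 0"
    using assms(2) by (metis finite sum_pos less_irrefl)
  moreover have "(\<Sum>i\<in>C k. d $ i *\<^sub>R deviation C d x i) =
      (\<Sum>i\<in>C k. d $ i *\<^sub>R x $ i - d $ i *\<^sub>R cluster_mean C d k x)"
    by (intro sum.cong refl) (simp add: deviation_def mem_cluster_iff[OF assms(1)] scaleR_diff_right)
  ultimately show ?thesis
    by (simp only: sum_subtractf scaleR_sum_left[symmetric]) (simp add: cluster_mean_def)
qed simp

text \<open>
  Why cluster means, their velocities and every other term common to a cluster disappear from the
  derivative of the Lyapunov function.
\<close>
lemma deviation_orthogonal: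
  fixes C :: "'k::finite \<Rightarrow> 'm::finite set"
  assumes "is_clustering C" "\<And>i. 0 < d $ i"
  shows "(\<Sum>i\<in>UNIV. d $ i * (deviation C d x i \<bullet> v (cluster_of C i))) = 0"
proof -
  have "(\<Sum>i\<in>C k. d $ i * (deviation C d x i \<bullet> v (cluster_of C i))) = 0" for k
  proof -
    have "(\<Sum>i\<in>C k. d $ i * (deviation C d x i \<bullet> v (cluster_of C i))) =
        (\<Sum>i\<in>C k. d $ i *\<^sub>R deviation C d x i) \<bullet> v k"
      unfolding inner_sum_left
      by (intro sum.cong refl) (simp add: mem_cluster_iff[OF assms(1)])
    then show ?thesis
      by (simp add: deviation_centred[OF assms])
  qed
  then show ?thesis
    by (simp add: sum_by_cluster[OF assms(1)])
qed

lemma semi_inner_product_matrix: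
  fixes \<Gamma> :: "real ^ 'n ^ 'n"
  assumes "transpose \<Gamma> = \<Gamma>" "nonneg_definite \<Gamma>"
  shows "semi_inner_product (\<lambda>u v. u \<bullet> (\<Gamma> *v v))"
proof
  show "bilinear (\<lambda>u v. u \<bullet> (\<Gamma> *v v))"
    unfolding bilinear_def
    by (auto intro!: linearI simp: inner_left_distrib inner_right_distrib algebra_simps)
  show "u \<bullet> (\<Gamma> *v v) = v \<bullet> (\<Gamma> *v u)" for u v
    using dot_lmul_matrix[of v \<Gamma> u] vector_transpose_matrix[of v \<Gamma>] assms(1)
    by (metis inner_commute)
  show "0 \<le> v \<bullet> (\<Gamma> *v v)" for v
    using assms(2) by (simp add: nonneg_definite_def)
qed

text \<open>
  Each difference \<open>x j - x i\<close> is the difference of the deviations plus that of the cluster means.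
  The former contributes the negative energy, the latter a term common to the cluster.
\<close>
lemma laplacian_coupling_dissipation:
  fixes E :: "('m::finite \<times> 'm) set" and C :: "'k::finite \<Rightarrow> 'm set"
    and \<Gamma> :: "real ^ 'n ^ 'n" and x :: "real ^ 'n ^ 'm"
  assumes E: "irrefl E" and cl: "is_clustering C"
    and d: "\<And>i. 0 < d $ i"
    and eig: "left_eigenvector (weighted_laplacian E C) 0 d"
    and common: "common_intercluster_coupling E C"
    and \<Gamma>: "transpose \<Gamma> = \<Gamma>" "nonneg_definite \<Gamma>"
  defines "a \<equiv> laplacian_offdiag E C" and "y \<equiv> deviation C d x"
  shows "(\<Sum>i\<in>UNIV. \<Sum>j\<in>UNIV. d $ i * a i j * (y i \<bullet> (\<Gamma> *v (x $ j - x $ i)))) =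
    - (\<Sum>i\<in>UNIV. \<Sum>j\<in>UNIV. d $ i * a i j * ((y i - y j) \<bullet> (\<Gamma> *v (y i - y j)))) / 2"
proof -
  interpret semi_inner_product "\<lambda>u v. u \<bullet> (\<Gamma> *v v)"
    by (rule semi_inner_product_matrix[OF \<Gamma>])
  define m where "m k = cluster_mean C d k x" for k
  obtain v where v: "\<And>i. (\<Sum>j\<in>UNIV. a i j *\<^sub>R (m (cluster_of C j) - m (cluster_of C i))) = v (cluster_of C i)"
    using intercluster_drift[OF cl common] unfolding a_def by blast
  have split: "x $ j - x $ i = (y j - y i) + (m (cluster_of C j) - m (cluster_of C i))" for i j
    by (simp add: y_def m_def deviation_def)
  have drift: "(\<Sum>j\<in>UNIV. d $ i * a i j * (y i \<bullet> (\<Gamma> *v (m (cluster_of C j) - m (cluster_of C i))))) =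
      d $ i * (y i \<bullet> (\<Gamma> *v v (cluster_of C i)))" for i
    unfolding v[symmetric] sum_right by (simp add: sum_distrib_left mult.assoc)
  have "(\<Sum>i\<in>UNIV. \<Sum>j\<in>UNIV. d $ i * a i j * (y i \<bullet> (\<Gamma> *v (x $ j - x $ i)))) =
      (\<Sum>i\<in>UNIV. \<Sum>j\<in>UNIV. d $ i * a i j * (y i \<bullet> (\<Gamma> *v (y j - y i)))) +
      (\<Sum>i\<in>UNIV. d $ i * (y i \<bullet> (\<Gamma> *v v (cluster_of C i))))"
    unfolding split by (simp only: matrix_vector_right_distrib inner_add_right distrib_left
        sum.distrib drift)
  also have "(\<Sum>i\<in>UNIV. d $ i * (y i \<bullet> (\<Gamma> *v v (cluster_of C i)))) = 0"
    unfolding y_def using deviation_orthogonal[OF cl d, of x "\<lambda>k. \<Gamma> *v v k"] .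
  also have "(\<Sum>i\<in>UNIV. \<Sum>j\<in>UNIV. d $ i * a i j * (y i \<bullet> (\<Gamma> *v (y j - y i)))) =
      - (\<Sum>i\<in>UNIV. \<Sum>j\<in>UNIV. d $ i * a i j * ((y i - y j) \<bullet> (\<Gamma> *v (y i - y j)))) / 2"
    by (intro energy_identity) (simp add: a_def laplacian_balanced[OF cl E eig])
  finally show ?thesis
    by simp
qed

definition velocity :: "('m::finite \<times> 'm) set \<Rightarrow> ('k \<Rightarrow> 'm set) \<Rightarrow> ('k \<Rightarrow> real ^ 'n \<Rightarrow> real ^ 'n) \<Rightarrow>
    real ^ 'n ^ 'n \<Rightarrow> real ^ 'm ^ 'm \<Rightarrow> real ^ 'n ^ 'm \<Rightarrow> real ^ 'n ^ 'm" where
  "velocity E C f \<Gamma> w x = (\<chi> i. f (cluster_of C i) (x $ i) +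
     (\<Sum>j\<in>UNIV. (adjacency E $ i $ j * w $ i $ j) *\<^sub>R (\<Gamma> *v (x $ j - x $ i))))"

lemma uniform_decreasing_rate:
  fixes f :: "'k::finite \<Rightarrow> real ^ 'n \<Rightarrow> real ^ 'n"
  assumes "\<And>k. decreasing_condition (f k) A"
  obtains \<delta> where "0 < \<delta>"
    and "\<And>k \<xi> \<zeta>. (\<xi> - \<zeta>) \<bullet> (f k \<xi> - f k \<zeta> - A *v (\<xi> - \<zeta>)) \<le> - \<delta> * ((\<xi> - \<zeta>) \<bullet> (\<xi> - \<zeta>))"
proof -
  obtain r where r: "\<And>k. 0 < r k"
    "\<And>k \<xi> \<zeta>. (\<xi> - \<zeta>) \<bullet> (f k \<xi> - f k \<zeta> - A *v (\<xi> - \<zeta>)) \<le> - r k * ((\<xi> - \<zeta>) \<bullet> (\<xi> - \<zeta>))"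
    using assms unfolding decreasing_condition_def by metis
  show thesis
  proof (rule that[of "Min (range r)"])
    show "0 < Min (range r)"
      using r(1) by simp
    show "(\<xi> - \<zeta>) \<bullet> (f k \<xi> - f k \<zeta> - A *v (\<xi> - \<zeta>)) \<le> - Min (range r) * ((\<xi> - \<zeta>) \<bullet> (\<xi> - \<zeta>))" for k \<xi> \<zeta>
    proof (rule order_trans[OF r(2)[of \<xi> \<zeta> k]], rule mult_right_mono)
      show "- r k \<le> - Min (range r)"
        by simp
    qed simp
  qed
qed

text \<open>
  The left-hand side is the derivative of the Lyapunov function along a solution that is in the
  state \<open>(x, w)\<close>.
\<close>
lemma lyapunov_dissipation:
  fixes E :: "('m::finite \<times> 'm) set" and C :: "'k::finite \<Rightarrow> 'm set"
    and f :: "'k \<Rightarrow> real ^ 'n \<Rightarrow> real ^ 'n" and \<Gamma> :: "real ^ 'n ^ 'n"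
  assumes E: "irrefl E" "connected_graph E" and cl: "is_clustering C"
    and d: "\<And>i. 0 < d $ i"
    and eig: "left_eigenvector (weighted_laplacian E C) 0 d"
    and common: "common_intercluster_coupling E C"
    and \<Gamma>: "transpose \<Gamma> = \<Gamma>" "nonneg_definite \<Gamma>"
    and dec: "\<And>k. decreasing_condition (f k) (\<alpha> *\<^sub>R \<Gamma>)"
  obtains \<kappa> \<delta> where "0 < \<delta>"
    and "\<And>x w. (\<Sum>i\<in>UNIV. d $ i * (deviation C d x i \<bullet> deviation C d (velocity E C f \<Gamma> w x) i)) +
      (\<Sum>i\<in>UNIV. \<Sum>j\<in>UNIV. adjacency E $ i $ j * (w $ i $ j - \<kappa> * laplacian_offdiag E C i j) *
          (d $ i * (deviation C d x i \<bullet> (\<Gamma> *v (x $ i - x $ j)))))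
      \<le> - \<delta> * (\<Sum>i\<in>UNIV. d $ i * (deviation C d x i \<bullet> deviation C d x i))"
proof -
  interpret semi_inner_product "\<lambda>u v. u \<bullet> (\<Gamma> *v v)"
    by (rule semi_inner_product_matrix[OF \<Gamma>])
  define a where "a = laplacian_offdiag E C"
  obtain \<delta> where \<delta>: "0 < \<delta>" "\<And>k \<xi> \<zeta>. (\<xi> - \<zeta>) \<bullet> (f k \<xi> - f k \<zeta> - (\<alpha> *\<^sub>R \<Gamma>) *v (\<xi> - \<zeta>)) \<le>
      - \<delta> * ((\<xi> - \<zeta>) \<bullet> (\<xi> - \<zeta>))"
    using uniform_decreasing_rate[of f "\<alpha> *\<^sub>R \<Gamma>", OF dec] by blast
  have weights: "0 \<le> d $ i * a i j" "(i, j) \<in> E \<Longrightarrow> 0 < d $ i * a i j" for i j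
    using d[of i] laplacian_offdiag_nonneg[OF cl, of E i j] laplacian_offdiag_pos[OF cl, of i j E]
    by (simp_all add: a_def)
  have cover: "(\<Union>k. C k) = UNIV"
    using cl by (simp add: is_clustering_def)
  obtain P where P: "0 \<le> P" "\<And>y. (\<And>k. (\<Sum>i\<in>C k. d $ i *\<^sub>R y i) = 0) \<Longrightarrow>
      (\<Sum>i\<in>UNIV. d $ i * (y i \<bullet> (\<Gamma> *v y i))) \<le>
      P * (\<Sum>i\<in>UNIV. \<Sum>j\<in>UNIV. d $ i * a i j * ((y i - y j) \<bullet> (\<Gamma> *v (y i - y j))))"
    using poincare_inequality[of "\<lambda>i j. d $ i * a i j" E "\<lambda>i. d $ i" C, OF weights E(2) d cover]
    by auto
  \<comment> \<open>The coupling contributes \<open>- \<kappa>/2\<close> times the energy, which has to outweigh \<open>\<bar>\<alpha>\<bar> P\<close> times the energy.\<close>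
  define \<kappa> where "\<kappa> = 2 * \<bar>\<alpha>\<bar> * P"
  have estimate: "(\<Sum>i\<in>UNIV. d $ i * (deviation C d x i \<bullet> deviation C d (velocity E C f \<Gamma> w x) i)) +
      (\<Sum>i\<in>UNIV. \<Sum>j\<in>UNIV. adjacency E $ i $ j * (w $ i $ j - \<kappa> * a i j) *
          (d $ i * (deviation C d x i \<bullet> (\<Gamma> *v (x $ i - x $ j)))))
      \<le> - \<delta> * (\<Sum>i\<in>UNIV. d $ i * (deviation C d x i \<bullet> deviation C d x i))" for x w
  proof -
    define y where "y = deviation C d x"
    define m where "m k = cluster_mean C d k x" for k
    define S where "S = (\<Sum>i\<in>UNIV. \<Sum>j\<in>UNIV. d $ i * a i j * ((y i - y j) \<bullet> (\<Gamma> *v (y i - y j))))"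
    define H where "H = (\<Sum>i\<in>UNIV. d $ i * (y i \<bullet> (\<Gamma> *v y i)))"
    let ?k = "cluster_of C"
    \<comment> \<open>The velocity of the cluster mean drops out.\<close>
    have mean_velocity: "(\<Sum>i\<in>UNIV. d $ i * (y i \<bullet> deviation C d (velocity E C f \<Gamma> w x) i)) =
        (\<Sum>i\<in>UNIV. d $ i * (y i \<bullet> velocity E C f \<Gamma> w x $ i))"
    proof -
      have "(\<Sum>i\<in>UNIV. d $ i * (y i \<bullet> cluster_mean C d (?k i) (velocity E C f \<Gamma> w x))) = 0"
        unfolding y_def by (rule deviation_orthogonal[OF cl d])
      then show ?thesis
        by (simp add: deviation_def[of C d "velocity E C f \<Gamma> w x"] inner_diff_right right_diff_distrib
            sum_subtractf)
    qed
    \<comment> \<open>The weight dynamics cancel \<open>w\<close>, and the constant weights \<open>\<kappa> a\<^sub>i\<^sub>j\<close> take its place.\<close>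
    have cancel: "d $ i * (y i \<bullet> velocity E C f \<Gamma> w x $ i) +
        (\<Sum>j\<in>UNIV. adjacency E $ i $ j * (w $ i $ j - \<kappa> * a i j) * (d $ i * (y i \<bullet> (\<Gamma> *v (x $ i - x $ j))))) =
        d $ i * (y i \<bullet> f (?k i) (x $ i)) + \<kappa> * (\<Sum>j\<in>UNIV. d $ i * a i j * (y i \<bullet> (\<Gamma> *v (x $ j - x $ i))))" for i
    proof -
      have "d $ i * (y i \<bullet> velocity E C f \<Gamma> w x $ i) = d $ i * (y i \<bullet> f (?k i) (x $ i)) +
          (\<Sum>j\<in>UNIV. adjacency E $ i $ j * w $ i $ j * (d $ i * (y i \<bullet> (\<Gamma> *v (x $ j - x $ i)))))"
        by (simp add: velocity_def inner_add_right inner_sum_right distrib_left sum_distrib_left mult_ac)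
      moreover have "adjacency E $ i $ j * w $ i $ j * (d $ i * (y i \<bullet> (\<Gamma> *v (x $ j - x $ i)))) +
          adjacency E $ i $ j * (w $ i $ j - \<kappa> * a i j) * (d $ i * (y i \<bullet> (\<Gamma> *v (x $ i - x $ j)))) =
          \<kappa> * (d $ i * a i j * (y i \<bullet> (\<Gamma> *v (x $ j - x $ i))))" for j
      proof -
        have "\<Gamma> *v (x $ i - x $ j) = - (\<Gamma> *v (x $ j - x $ i))"
          by (simp add: matrix_vector_mult_diff_distrib)
        moreover have "adjacency E $ i $ j * a i j = a i j"
          by (simp add: adjacency_def a_def laplacian_offdiag_eq[OF cl])
        ultimately show ?thesis
          by (simp add: left_diff_distrib right_diff_distrib) (auto simp: mult_ac)
      qed
      ultimately show ?thesis
        by (simp add: sum_distrib_left flip: sum.distrib)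
    qed
    have dissipation: "(\<Sum>i\<in>UNIV. \<Sum>j\<in>UNIV. d $ i * a i j * (y i \<bullet> (\<Gamma> *v (x $ j - x $ i)))) = - S / 2"
      unfolding S_def a_def y_def by (rule laplacian_coupling_dissipation[OF E(1) cl d eig common \<Gamma>])
    have "\<alpha> * H \<le> \<bar>\<alpha>\<bar> * H"
      unfolding H_def by (intro mult_right_mono sum_nonneg mult_nonneg_nonneg nonneg)
        (auto intro: less_imp_le[OF d])
    also have "\<dots> \<le> \<bar>\<alpha>\<bar> * (P * S)"
      unfolding H_def S_def by (intro mult_left_mono P(2)) (simp_all add: y_def deviation_centred[OF cl d])
    finally have coupling: "\<alpha> * H + \<kappa> * (- S / 2) \<le> 0"
      by (simp add: \<kappa>_def)
    \<comment> \<open>Subtracting \<open>f\<close> at the cluster mean costs nothing and puts the decreasing condition in force.\<close>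
    have "(\<Sum>i\<in>UNIV. d $ i * (y i \<bullet> f (?k i) (x $ i))) =
        (\<Sum>i\<in>UNIV. d $ i * (y i \<bullet> (f (?k i) (x $ i) - f (?k i) (m (?k i)))))"
      using deviation_orthogonal[OF cl d, of x "\<lambda>k. f k (m k)"]
      by (simp add: y_def inner_diff_right right_diff_distrib sum_subtractf)
    also have "\<dots> \<le> (\<Sum>i\<in>UNIV. d $ i * (\<alpha> * (y i \<bullet> (\<Gamma> *v y i)) - \<delta> * (y i \<bullet> y i)))"
    proof (intro sum_mono mult_left_mono less_imp_le[OF d])
      fix i
      have "y i = x $ i - m (?k i)"
        by (simp add: y_def m_def deviation_def)
      then show "y i \<bullet> (f (?k i) (x $ i) - f (?k i) (m (?k i))) \<le> \<alpha> * (y i \<bullet> (\<Gamma> *v y i)) - \<delta> * (y i \<bullet> y i)"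
        using \<delta>(2)[of "x $ i" "m (?k i)" "?k i"]
        by (simp add: inner_diff_right flip: scaleR_matrix_vector_assoc)
    qed
    also have "\<dots> = \<alpha> * H - \<delta> * (\<Sum>i\<in>UNIV. d $ i * (y i \<bullet> y i))"
      by (simp add: H_def right_diff_distrib sum_subtractf sum_distrib_left mult.left_commute)
    finally have nodes: "(\<Sum>i\<in>UNIV. d $ i * (y i \<bullet> f (?k i) (x $ i))) \<le>
        \<alpha> * H - \<delta> * (\<Sum>i\<in>UNIV. d $ i * (y i \<bullet> y i))" .
    have "(\<Sum>i\<in>UNIV. d $ i * (y i \<bullet> deviation C d (velocity E C f \<Gamma> w x) i)) +
        (\<Sum>i\<in>UNIV. \<Sum>j\<in>UNIV. adjacency E $ i $ j * (w $ i $ j - \<kappa> * a i j) * (d $ i * (y i \<bullet> (\<Gamma> *v (x $ i - x $ j)))))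
        = (\<Sum>i\<in>UNIV. d $ i * (y i \<bullet> f (?k i) (x $ i))) + \<kappa> * (- S / 2)"
      unfolding mean_velocity sum.distrib[symmetric] cancel
      unfolding sum.distrib sum_distrib_left[symmetric] dissipation ..
    then show ?thesis
      using nodes coupling unfolding y_def by linarith
  qed
  show thesis
    using that[OF \<delta>(1), of \<kappa>] estimate unfolding a_def by blast
qed

section \<open>Cluster synchronization\<close>

lemma deviation_has_vector_derivative:
  assumes "\<And>i. ((\<lambda>s. x s $ i) has_vector_derivative v $ i) F"
  shows "((\<lambda>s. deviation C d (x s) i) has_vector_derivative deviation C d v i) F"
  unfolding deviation_def cluster_mean_def
  by (intro has_vector_derivative_diff has_vector_derivative_sum assms
      bounded_linear.has_vector_derivative[OF bounded_linear_scaleR_right])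

lemma inner_self_has_real_derivative:
  fixes u :: "real \<Rightarrow> 'a::real_inner"
  assumes "(u has_vector_derivative u') (at t within J)"
  shows "((\<lambda>s. u s \<bullet> u s) has_real_derivative 2 * (u t \<bullet> u')) (at t within J)"
  using bounded_bilinear.has_vector_derivative[OF bounded_bilinear_inner assms assms]
  by (simp add: has_real_derivative_iff_has_vector_derivative inner_commute)

lemma bounded_vecI:
  fixes g :: "'b \<Rightarrow> 'a::real_normed_vector ^ 'm::finite"
  assumes "\<And>i. bounded ((\<lambda>t. g t $ i) ` J)"
  shows "bounded (g ` J)"
proof -
  from assms have "\<forall>i. \<exists>b. \<forall>t\<in>J. norm (g t $ i) \<le> b"
    by (simp add: bounded_iff)
  from choice[OF this] obtain b where b: "\<And>i t. t \<in> J \<Longrightarrow> norm (g t $ i) \<le> b i"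
    by blast
  have "norm (g t) \<le> (\<Sum>i\<in>UNIV. b i)" if "t \<in> J" for t
    unfolding norm_vec_def using b[OF that]
    by (intro order_trans[OF L2_set_le_sum] sum_mono) auto
  then show ?thesis
    by (auto simp: bounded_iff)
qed

text \<open>
  The sum is half the derivative of the deviation energy.  It is a continuous function of positions
  and edge weights, hence bounded on the compact closure of a bounded trajectory.
\<close>
lemma deviation_energy_rate_bounded:
  fixes E :: "('m::finite \<times> 'm) set" and C :: "'k::finite \<Rightarrow> 'm set"
    and f :: "'k \<Rightarrow> real ^ 'n \<Rightarrow> real ^ 'n"
  assumes f: "\<And>k. continuous_on UNIV (f k)"
    and x: "bounded (x ` J)" and w: "\<And>i j. (i, j) \<in> E \<Longrightarrow> bounded ((\<lambda>t. w t $ i $ j) ` J)"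
  obtains K where "\<And>t. t \<in> J \<Longrightarrow>
    \<bar>\<Sum>i\<in>UNIV. d $ i * (deviation C d (x t) i \<bullet> deviation C d (velocity E C f \<Gamma> (w t) (x t)) i)\<bar> \<le> K"
proof -
  define G where "G z = (\<Sum>i\<in>UNIV. d $ i * (deviation C d (snd z) i \<bullet>
      deviation C d (velocity E C f \<Gamma> (fst z) (snd z)) i))" for z :: "(real ^ 'm ^ 'm) \<times> (real ^ 'n ^ 'm)"
  \<comment> \<open>Entries off the edges are arbitrary functions of time, so they are set to zero first.\<close>
  define w' where "w' t = (\<chi> i j. adjacency E $ i $ j * w t $ i $ j)" for t
  have G_w': "G (w' t, x t) = (\<Sum>i\<in>UNIV. d $ i * (deviation C d (x t) i \<bullet>
      deviation C d (velocity E C f \<Gamma> (w t) (x t)) i))" for t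
  proof -
    have "adjacency E $ i $ j * (adjacency E $ i $ j * r) = adjacency E $ i $ j * r" for i j r
      by (simp add: adjacency_def)
    then show ?thesis
      by (simp only: G_def w'_def velocity_def vec_lambda_beta fst_conv snd_conv)
  qed
  have cont: "continuous_on UNIV G"
    unfolding G_def velocity_def deviation_def cluster_mean_def
    by (intro continuous_intros continuous_on_vec_lambda continuous_on_compose2[OF f]
        bounded_linear.continuous_on[OF matrix_vector_mul_bounded_linear]) auto
  have "bounded ((\<lambda>t. w' t $ i $ j) ` J)" for i j
  proof (cases "(i, j) \<in> E")
    case True
    then show ?thesis
      using w by (simp add: w'_def adjacency_def)
  next
    case False
    have "(\<lambda>t. w' t $ i $ j) ` J \<subseteq> {0}"
      using False by (auto simp: w'_def adjacency_def)
    then show ?thesis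
      by (rule bounded_subset[rotated]) simp
  qed
  then have "bounded (w' ` J)"
    by (intro bounded_vecI)
  then have "bounded ((\<lambda>t. (w' t, x t)) ` J)"
    using bounded_Times x by (rule_tac bounded_subset[of "w' ` J \<times> x ` J"]) auto
  then have "compact (G ` closure ((\<lambda>t. (w' t, x t)) ` J))"
    by (intro compact_continuous_image continuous_on_subset[OF cont]) auto
  from compact_imp_bounded[OF this]
  obtain K where K: "\<forall>r \<in> G ` closure ((\<lambda>t. (w' t, x t)) ` J). norm r \<le> K"
    unfolding bounded_iff by (rule exE)
  show thesis
  proof (rule that)
    fix t assume "t \<in> J"
    then have "(w' t, x t) \<in> closure ((\<lambda>t. (w' t, x t)) ` J)"
      using closure_subset by fast
    with K have "norm (G (w' t, x t)) \<le> K"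
      by (rule_tac bspec[OF _ imageI])
    then show "\<bar>\<Sum>i\<in>UNIV. d $ i * (deviation C d (x t) i \<bullet>
        deviation C d (velocity E C f \<Gamma> (w t) (x t)) i)\<bar> \<le> K"
      by (simp add: G_w')
  qed
qed

lemma bounded_solution_synchronizes:
  fixes E :: "('m::finite \<times> 'm) set" and C :: "'k::finite \<Rightarrow> 'm set"
    and f :: "'k \<Rightarrow> real ^ 'n \<Rightarrow> real ^ 'n" and \<Gamma> :: "real ^ 'n ^ 'n"
  assumes E: "irrefl E" "connected_graph E" and cl: "is_clustering C"
    and d: "\<And>i. 0 < d $ i"
    and eig: "left_eigenvector (weighted_laplacian E C) 0 d"
    and f: "\<And>k. continuous_on UNIV (f k)"
    and \<rho>: "\<And>i j. (i, j) \<in> E \<Longrightarrow> 0 < \<rho> i j"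
    and common: "common_intercluster_coupling E C"
    and \<Gamma>: "transpose \<Gamma> = \<Gamma>" "nonneg_definite \<Gamma>"
    and dec: "\<And>k. decreasing_condition (f k) (\<alpha> *\<^sub>R \<Gamma>)"
    and sol: "adaptive_solution E C f \<Gamma> d \<rho> {0..} x w"
    and x_bounded: "bounded (x ` {0..})"
    and w_bounded: "\<And>i j. (i, j) \<in> E \<Longrightarrow> bounded ((\<lambda>t. w t $ i $ j) ` {0..})"
    and ij: "i \<in> C k" "j \<in> C k"
  shows "((\<lambda>t. x t $ i - x t $ j) \<longlongrightarrow> 0) at_top"
proof -
  define y where "y t = deviation C d (x t)" for t
  define y' where "y' t = deviation C d (velocity E C f \<Gamma> (w t) (x t))" for t
  obtain \<kappa> \<delta> where \<kappa>: "0 < \<delta>"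
    "\<And>t. (\<Sum>i\<in>UNIV. d $ i * (y t i \<bullet> y' t i)) +
      (\<Sum>i\<in>UNIV. \<Sum>j\<in>UNIV. adjacency E $ i $ j * (w t $ i $ j - \<kappa> * laplacian_offdiag E C i j) *
          (d $ i * (y t i \<bullet> (\<Gamma> *v (x t $ i - x t $ j)))))
      \<le> - \<delta> * (\<Sum>i\<in>UNIV. d $ i * (y t i \<bullet> y t i))"
    by (rule lyapunov_dissipation[OF E cl d eig common \<Gamma> dec], rule that)
      (simp_all only: y_def y'_def)
  obtain K where K: "\<And>t. t \<in> {0..} \<Longrightarrow> \<bar>\<Sum>i\<in>UNIV. d $ i * (y t i \<bullet> y' t i)\<bar> \<le> K"
    by (rule deviation_energy_rate_bounded[OF f x_bounded w_bounded,
        where d = d and C = C and \<Gamma> = \<Gamma>],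
        assumption, rule that) (simp only: y_def y'_def)
  define V where "V t = (\<Sum>i\<in>UNIV. d $ i * (y t i \<bullet> y t i))" for t
  \<comment> \<open>The Lyapunov function is \<open>V / 2 + W\<close>.\<close>
  define W where "W t = (\<Sum>i\<in>UNIV. \<Sum>j\<in>UNIV. adjacency E $ i $ j *
      ((w t $ i $ j - \<kappa> * laplacian_offdiag E C i j)\<^sup>2 / (2 * \<rho> i j)))" for t
  have y: "((\<lambda>s. y s i) has_vector_derivative y' t i) (at t within {0..})" if "0 \<le> t" for i t
    unfolding y_def y'_def
  proof (rule deviation_has_vector_derivative)
    fix i
    have "i \<in> C (cluster_of C i)"
      by (simp add: mem_cluster_iff[OF cl])
    then show "((\<lambda>s. x s $ i) has_vector_derivative velocity E C f \<Gamma> (w t) (x t) $ i) (at t within {0..})"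
      using sol that unfolding adaptive_solution_def velocity_def by simp
  qed
  have w: "((\<lambda>s. w s $ i $ j) has_real_derivative
      \<rho> i j * d $ i * (y t i \<bullet> (\<Gamma> *v (x t $ i - x t $ j)))) (at t within {0..})"
    if "0 \<le> t" "(i, j) \<in> E" for i j t
  proof -
    have "i \<in> C (cluster_of C i)"
      by (simp add: mem_cluster_iff[OF cl])
    then show ?thesis
      using sol that unfolding adaptive_solution_def y_def deviation_def by simp
  qed
  have V': "(V has_real_derivative 2 * (\<Sum>i\<in>UNIV. d $ i * (y t i \<bullet> y' t i))) (at t within {0..})"
    if "0 \<le> t" for t
  proof -
    have "(V has_real_derivative (\<Sum>i\<in>UNIV. d $ i * (2 * (y t i \<bullet> y' t i)))) (at t within {0..})"
      unfolding V_def
      by (intro DERIV_sum DERIV_cmult inner_self_has_real_derivative y that)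
    then show ?thesis
      by (simp add: sum_distrib_left mult.left_commute)
  qed
  have W': "(W has_real_derivative (\<Sum>i\<in>UNIV. \<Sum>j\<in>UNIV. adjacency E $ i $ j *
      (w t $ i $ j - \<kappa> * laplacian_offdiag E C i j) * (d $ i * (y t i \<bullet> (\<Gamma> *v (x t $ i - x t $ j))))))
      (at t within {0..})" if "0 \<le> t" for t
    unfolding W_def
  proof (intro DERIV_sum)
    fix i j
    show "((\<lambda>t. adjacency E $ i $ j * ((w t $ i $ j - \<kappa> * laplacian_offdiag E C i j)\<^sup>2 / (2 * \<rho> i j)))
        has_real_derivative adjacency E $ i $ j * (w t $ i $ j - \<kappa> * laplacian_offdiag E C i j) *
          (d $ i * (y t i \<bullet> (\<Gamma> *v (x t $ i - x t $ j))))) (at t within {0..})"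
    proof (cases "(i, j) \<in> E")
      case True
      then show ?thesis
        using \<rho>[OF True]
        by (auto intro!: derivative_eq_intros w[OF that True] simp: adjacency_def)
    next
      case False
      then show ?thesis
        by (simp add: adjacency_def)
    qed
  qed
  have V_nonneg: "0 \<le> V t" for t
    unfolding V_def by (intro sum_nonneg mult_nonneg_nonneg less_imp_le[OF d]) simp
  have W_nonneg: "0 \<le> W t" for t
    unfolding W_def using \<rho> by (auto intro!: sum_nonneg simp: adjacency_def less_imp_le)
  have V_0: "(V \<longlongrightarrow> 0) at_top"
  proof (rule dissipated_tendsto_zero)
    fix t :: real assume t: "0 \<le> t"
    show "((\<lambda>t. V t / 2 + W t) has_real_derivative
      (\<Sum>i\<in>UNIV. d $ i * (y t i \<bullet> y' t i)) +
      (\<Sum>i\<in>UNIV. \<Sum>j\<in>UNIV. adjacency E $ i $ j * (w t $ i $ j - \<kappa> * laplacian_offdiag E C i j) *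
          (d $ i * (y t i \<bullet> (\<Gamma> *v (x t $ i - x t $ j)))))) (at t within {0..})"
      using DERIV_add[OF DERIV_cdivide[OF V'[OF t], of 2] W'[OF t]] by simp
    show "(V has_real_derivative 2 * (\<Sum>i\<in>UNIV. d $ i * (y t i \<bullet> y' t i))) (at t within {0..})"
      by (rule V'[OF t])
    show "(\<Sum>i\<in>UNIV. d $ i * (y t i \<bullet> y' t i)) +
      (\<Sum>i\<in>UNIV. \<Sum>j\<in>UNIV. adjacency E $ i $ j * (w t $ i $ j - \<kappa> * laplacian_offdiag E C i j) *
          (d $ i * (y t i \<bullet> (\<Gamma> *v (x t $ i - x t $ j)))))
      \<le> - \<delta> * V t"
      unfolding V_def by (rule \<kappa>(2))
    show "\<bar>2 * (\<Sum>i\<in>UNIV. d $ i * (y t i \<bullet> y' t i))\<bar> \<le> 2 * K"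
      using K[of t] t by (simp add: abs_mult)
  qed (use V_nonneg W_nonneg \<kappa>(1) in auto)
  have y_0: "((\<lambda>t. y t i) \<longlongrightarrow> 0) at_top" for i
  proof -
    have "norm (y t i) \<le> sqrt (V t / d $ i)" for t
    proof (rule real_le_rsqrt)
      have "d $ i * (y t i \<bullet> y t i) \<le> V t"
        unfolding V_def by (rule member_le_sum) (auto intro!: mult_nonneg_nonneg less_imp_le[OF d])
      then show "(norm (y t i))\<^sup>2 \<le> V t / d $ i"
        using d[of i] by (simp add: pos_le_divide_eq power2_norm_eq_inner mult.commute)
    qed
    moreover have "((\<lambda>t. sqrt (V t / d $ i)) \<longlongrightarrow> 0) at_top"
      using tendsto_real_sqrt[OF tendsto_divide[OF V_0 tendsto_const[of "d $ i"]]] d[of i] by simp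
    ultimately show ?thesis
      by (intro Lim_null_comparison[of "\<lambda>t. y t i"]) auto
  qed
  have "x t $ i - x t $ j = y t i - y t j" for t
    using ij by (simp add: y_def deviation_def mem_cluster_iff[OF cl])
  then show ?thesis
    using tendsto_diff[OF y_0[of i] y_0[of j]] by simp
qed

theorem theorem3:
  fixes E :: "('m::finite \<times> 'm) set"
    and C :: "'k::finite \<Rightarrow> 'm set"
    and d dhat :: "real ^ 'm"
    and f :: "'k \<Rightarrow> real ^ 'n::finite \<Rightarrow> real ^ 'n"
    and \<Gamma> :: "real ^ 'n ^ 'n"
    and \<rho> :: "'m \<Rightarrow> 'm \<Rightarrow> real"
    and \<alpha> c :: real
  assumes "simple_bidirected_graph E"
    and "connected_graph E"
    and "is_clustering C"
    and "\<And>i. d $ i > 0"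
    and "left_eigenvector (weighted_laplacian E C) 0 d"
    and "\<And>k. continuous_on UNIV (f k)"
    and "\<And>i j. (i, j) \<in> E \<Longrightarrow> \<rho> i j > 0"
    and "common_intercluster_coupling E C"
    and "transpose \<Gamma> = \<Gamma>"
    and "nonneg_definite \<Gamma>"
    and "\<And>k. decreasing_condition (f k) (\<alpha> *\<^sub>R \<Gamma>)"
    and "c > 0"
    and "pos_definite (diag_matrix dhat)"
    and "nonpos_on (sym_part (diag_matrix dhat ** (c *\<^sub>R weighted_laplacian E C + \<alpha> *\<^sub>R mat 1)))
           (transverse_space C dhat)"
    and "essentially_bounded E C f \<Gamma> d \<rho>"
  shows "cluster_synchronizes E C f \<Gamma> d \<rho>"
  unfolding cluster_synchronizes_def
proof (intro allI impI ballI)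
  fix x w k i j
  assume sol: "adaptive_solution E C f \<Gamma> d \<rho> {0..} x w" and ij: "i \<in> C k" "j \<in> C k"
  have "irrefl E"
    using assms(1) by (simp add: simple_bidirected_graph_def)
  moreover have "bounded (x ` {0..})" "\<And>i j. (i, j) \<in> E \<Longrightarrow> bounded ((\<lambda>t. w t $ i $ j) ` {0..})"
    using assms(15) sol unfolding essentially_bounded_def by blast+
  ultimately show "((\<lambda>t. x t $ i - x t $ j) \<longlongrightarrow> 0) at_top"
    using assms(2-11) sol ij by (intro bounded_solution_synchronizes)
qed

end
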